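(* Consider the queueing network, with parameters $V>0$, $C\ge0$ and all queues initially zero ($Q_n^{(c)}(0)=0$, $H_m(0)=0$). Let the sequence $\omega(t)=[(A_1(t),\ldots,A_M(t));S(t)]$, $t\in\{0,1,2,\ldots\}$, be arbitrary. Suppose that the decisions of every slot form a $C$-approximate implementation of the scheduling algorithm. Let $B$ and $D$ be finite constants satisfying, for all $t$ and all possible decisions on slot $t$, $$B\ge\tfrac12\sum_{m=1}^M(A_m^{max})^2+\tfrac12\sum_{n,c}[b_n^{(c)}(t)^2+a_n^{(c)}(t)^2],$$ $$D\ge\tfrac12\sum_{n,c}\max[b_n^{(c),max},a_n^{(c),max}]\max[b_n^{(c)}(t),a_n^{(c)}(t)]+\tfrac12\sum_{m=1}^M(A_m^{max})^2 .$$ Then for all positive integers $R$ and $T$, with $\overline{x}_m=\frac1{RT}\sum_{\tau=0}^{RT-1}x_m(\tau)$ and $\overline{x}=(\overline{x}_1,\ldots,\overline{x}_M)$, $$\phi(\overline{x})\ge\frac1R\sum_{r=0}^{R-1}\Phi_r^*-\frac{B+C}{V}-\frac{D(T-1)}{V}-\sum_{m=1}^M\frac{\nu_m(V\nu_m+A_m^{max})}{RT}.$$ Equivalently, $\phi(\overline{x})\ge\frac1R\sum_{r=0}^{R-1}\Phi_r^*-\frac{B_1T}{V}-\frac{B_2V}{RT}$ with $B_1=(B+C-D)/T+D$ and $B_2=\sum_{m=1}^M\nu_m(\nu_m+A_m^{max}/V)$.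
   Context: Network model. Time is slotted, $t\in\{0,1,2,\ldots\}$. There are $N$ nodes and $M$ sessions; session $m$ has a source node $n_m$ and a destination node $c_m$. $A_m(t)$ is the exogenous data arriving for session $m$ on slot $t$, $0\le A_m(t)\le A_m^{max}<\infty$. Flow control decisions $x_m(t)$ satisfy $0\le x_m(t)\le A_m(t)$. Data destined for node $c$ is called commodity $c$; $\mathcal{M}_n^{(c)}$ is the set of sessions with source $n$ and destination $c$. $S(t)$ is an arbitrary topology state; a resource allocation $I(t)$ is chosen in a set $\mathcal{I}_{S(t)}$, and gives link rates $C_{ij}(I(t),S(t))$, $i\ne j$, with $0\le C_{ij}(\cdot,\cdot)\le\mu_{ij}^{max}<\infty$ (put $C_{ii}=0$). Transmission variables $\mu_{ij}^{(c)}(t)$, $i,j,c\in\{1,\ldots,N\}$, must satisfy $\mu_{ij}^{(c)}(t)\ge0$, $\mu_{ii}^{(c)}(t)=\mu_{ij}^{(i)}(t)=0$, and $\sum_{c}\mu_{ij}^{(c)}(t)\le C_{ij}(I(t),S(t))$. No probability model is assumed. The action is $\alpha(t)=[I(t);(\mu_{ij}^{(c)}(t));(x_m(t))]$, and $\mathcal{A}_{\omega(t)}$ is the set of all actions such that $I(t)\in\mathcal{I}_{S(t)}$; $\mu_{ij}^{(c)}(t)\ge0$, $\mu_{ii}^{(c)}(t)=\mu_{ij}^{(i)}(t)=0$ and $\sum_{c}\mu_{ij}^{(c)}(t)\le C_{ij}(I(t),S(t))$ for all $i,j,c\in\{1,\ldots,N\}$; and $0\le x_m(t)\le A_m(t)$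 for all $m\in\{1,\ldots,M\}$. Define $b_n^{(c)}(t)=\sum_j\mu_{nj}^{(c)}(t)$ and $a_n^{(c)}(t)=\sum_i\mu_{in}^{(c)}(t)+\sum_{m\in\mathcal{M}_n^{(c)}}x_m(t)$; $b_n^{(c),max}$, $a_n^{(c),max}$ are finite upper bounds on these over all slots and decisions. Queues: $Q_n^{(n)}(t)=0$ for all $t$, and for $n\ne c$, $Q_n^{(c)}(t+1)=\max[Q_n^{(c)}(t)-b_n^{(c)}(t),0]+a_n^{(c)}(t)$. Virtual queues with auxiliary variables $\gamma_m(t)\in[0,A_m^{max}]$: $H_m(t+1)=H_m(t)+\gamma_m(t)-x_m(t)$. Utility: $\phi(x)=\sum_{m=1}^M\phi_m(x_m)$, where each $\phi_m$ is continuous, concave and non-decreasing on $[0,A_m^{max}]$ with right derivative $\nu_m$ at $0$, $0\le\nu_m<\infty$. Scheduling algorithm and $C$-approximate implementation: the exact algorithm chooses, on every slot $t$, given $\omega(t)$ and the current queues, an action $\alpha(t)\in\mathcal{A}_{\omega(t)}$ and auxiliary variables $\gamma(t)\in\prod_m[0,A_m^{max}]$ that minimize $$-V\sum_m\phi_m(\gamma_m(t))+\sum_{n,c}Q_n^{(c)}(t)[a_n^{(c)}(t)-b_n^{(c)}(t)]+\sum_mH_m(t)[\gamma_m(t)-x_m(t)].$$ A $C$-approximate implementation is one in which, on every slot $t$, the chosen $\alpha(t)\in\mathcal{A}_{\omega(t)}$ and $\gamma(t)\in\prod_m[0,A_m^{max}]$ give a value of this expression within the additive constant $C\ge0$ of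 its infimum over all allowed $\alpha(t),\gamma(t)$. $T$-slot lookahead utility: $\Phi_r^*$ is the supremum of $\phi(\gamma)$, $\gamma_m=\frac1T\sum_{\tau=rT}^{(r+1)T-1}x_m(\tau)$, over all actions $\alpha(\tau)\in\mathcal{A}_{\omega(\tau)}$, $\tau\in\{rT,\ldots,(r+1)T-1\}$ (chosen with full knowledge of $\omega$ over the frame), subject to $\frac1T\sum_{\tau=rT}^{(r+1)T-1}[a_n^{(c)}(\tau)-b_n^{(c)}(\tau)]\le0$ for all $n\ne c$. *)

theory Defs
  imports "HOL-Analysis.Analysis"
begin

text \<open>
  Nodes are \<open>1..N\<close> and sessions are \<open>1..M\<close>; values of the indexed families outside these ranges
  are never used. The parameter \<open>'s\<close> is the type of topology states and \<open>'i\<close> the type of resource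
  allocations; \<open>link_rate G I S i j\<close> is $C_{ij}(I,S)$.
\<close>

record ('s, 'i) network =
  num_nodes :: nat
  num_sessions :: nat
  source :: "nat \<Rightarrow> nat"
  destination :: "nat \<Rightarrow> nat"
  arrival_max :: "nat \<Rightarrow> real"
  allocations :: "'s \<Rightarrow> 'i set"
  link_rate :: "'i \<Rightarrow> 's \<Rightarrow> nat \<Rightarrow> nat \<Rightarrow> real"
  link_rate_max :: "nat \<Rightarrow> nat \<Rightarrow> real"

definition nodes :: "('s, 'i) network \<Rightarrow> nat set" where
  "nodes G = {1..num_nodes G}"

definition sessions :: "('s, 'i) network \<Rightarrow> nat set" where
  "sessions G = {1..num_sessions G}"

definition valid_network :: "('s, 'i) network \<Rightarrow> bool" where
  "valid_network G \<longleftrightarrow>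
     (\<forall>m\<in>sessions G. source G m \<in> nodes G \<and> destination G m \<in> nodes G) \<and>
     (\<forall>S. \<forall>I\<in>allocations G S. \<forall>i\<in>nodes G. \<forall>j\<in>nodes G.
        (i \<noteq> j \<longrightarrow> 0 \<le> link_rate G I S i j \<and> link_rate G I S i j \<le> link_rate_max G i j) \<and>
        (i = j \<longrightarrow> link_rate G I S i j = 0))"

text \<open>An event $\omega(t)$ is the pair of the arrival vector $(A_m(t))_m$ and the topology state $S(t)$.\<close>

type_synonym 's event = "(nat \<Rightarrow> real) \<times> 's"

definition valid_event :: "('s, 'i) network \<Rightarrow> 's event \<Rightarrow> bool" where
  "valid_event G w \<longleftrightarrow> (\<forall>m\<in>sessions G. 0 \<le> fst w m \<and> fst w m \<le> arrival_max G m)"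

text \<open>The value \<open>transmit \<alpha> i j c\<close> is $\mu_{ij}^{(c)}$ and \<open>admit \<alpha> m\<close> is $x_m$.\<close>

record 'i action =
  allocation :: 'i
  transmit :: "nat \<Rightarrow> nat \<Rightarrow> nat \<Rightarrow> real"
  admit :: "nat \<Rightarrow> real"

definition actions :: "('s, 'i) network \<Rightarrow> 's event \<Rightarrow> 'i action set" where
  "actions G w = {\<alpha>.
     allocation \<alpha> \<in> allocations G (snd w) \<and>
     (\<forall>i\<in>nodes G. \<forall>j\<in>nodes G. \<forall>c\<in>nodes G. 0 \<le> transmit \<alpha> i j c) \<and>
     (\<forall>i\<in>nodes G. \<forall>c\<in>nodes G. transmit \<alpha> i i c = 0) \<and>
     (\<forall>i\<in>nodes G. \<forall>j\<in>nodes G. transmit \<alpha> i j i = 0) \<and>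
     (\<forall>i\<in>nodes G. \<forall>j\<in>nodes G.
        (\<Sum>c\<in>nodes G. transmit \<alpha> i j c) \<le> link_rate G (allocation \<alpha>) (snd w) i j) \<and>
     (\<forall>m\<in>sessions G. 0 \<le> admit \<alpha> m \<and> admit \<alpha> m \<le> fst w m)}"

definition outflow :: "('s, 'i) network \<Rightarrow> 'i action \<Rightarrow> nat \<Rightarrow> nat \<Rightarrow> real" where
  "outflow G \<alpha> n c = (\<Sum>j\<in>nodes G. transmit \<alpha> n j c)"

definition inflow :: "('s, 'i) network \<Rightarrow> 'i action \<Rightarrow> nat \<Rightarrow> nat \<Rightarrow> real" where
  "inflow G \<alpha> n c = (\<Sum>i\<in>nodes G. transmit \<alpha> i n c) +
     (\<Sum>m\<in>{m \<in> sessions G. source G m = n \<and> destination G m = c}. admit \<alpha> m)"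

definition aux_vectors :: "('s, 'i) network \<Rightarrow> (nat \<Rightarrow> real) set" where
  "aux_vectors G = {\<gamma>. \<forall>m\<in>sessions G. \<gamma> m \<in> {0..arrival_max G m}}"

definition queue_dynamics ::
  "('s, 'i) network \<Rightarrow> (nat \<Rightarrow> 'i action) \<Rightarrow> (nat \<Rightarrow> nat \<Rightarrow> nat \<Rightarrow> real) \<Rightarrow> bool" where
  "queue_dynamics G \<alpha> Q \<longleftrightarrow>
     (\<forall>t. \<forall>n\<in>nodes G. Q t n n = 0) \<and>
     (\<forall>t. \<forall>n\<in>nodes G. \<forall>c\<in>nodes G. n \<noteq> c \<longrightarrow>
        Q (Suc t) n c = max (Q t n c - outflow G (\<alpha> t) n c) 0 + inflow G (\<alpha> t) n c)"

definition virtual_queue_dynamics ::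
  "('s, 'i) network \<Rightarrow> (nat \<Rightarrow> 'i action) \<Rightarrow> (nat \<Rightarrow> nat \<Rightarrow> real) \<Rightarrow> (nat \<Rightarrow> nat \<Rightarrow> real) \<Rightarrow> bool" where
  "virtual_queue_dynamics G \<alpha> \<gamma> H \<longleftrightarrow>
     (\<forall>t. \<forall>m\<in>sessions G. H (Suc t) m = H t m + \<gamma> t m - admit (\<alpha> t) m)"

definition utility :: "('s, 'i) network \<Rightarrow> (nat \<Rightarrow> real \<Rightarrow> real) \<Rightarrow> (nat \<Rightarrow> real) \<Rightarrow> real" where
  "utility G \<phi> x = (\<Sum>m\<in>sessions G. \<phi> m (x m))"

text \<open>
  The right derivative at 0 is taken within the domain \<open>{0..arrival_max G m}\<close> of the utility
  function. If this domain is \<open>{0}\<close>, any \<open>\<nu> m \<ge> 0\<close> qualifies.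
\<close>

definition valid_utilities ::
  "('s, 'i) network \<Rightarrow> (nat \<Rightarrow> real \<Rightarrow> real) \<Rightarrow> (nat \<Rightarrow> real) \<Rightarrow> bool" where
  "valid_utilities G \<phi> \<nu> \<longleftrightarrow>
     (\<forall>m\<in>sessions G.
        continuous_on {0..arrival_max G m} (\<phi> m) \<and>
        concave_on {0..arrival_max G m} (\<phi> m) \<and>
        mono_on {0..arrival_max G m} (\<phi> m) \<and>
        (\<phi> m has_real_derivative \<nu> m) (at 0 within {0..arrival_max G m}) \<and>
        0 \<le> \<nu> m)"

definition scheduling_cost ::
  "('s, 'i) network \<Rightarrow> (nat \<Rightarrow> real \<Rightarrow> real) \<Rightarrow> real \<Rightarrow> (nat \<Rightarrow> nat \<Rightarrow> real) \<Rightarrow> (nat \<Rightarrow> real) \<Rightarrow>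
     'i action \<Rightarrow> (nat \<Rightarrow> real) \<Rightarrow> real" where
  "scheduling_cost G \<phi> V q h \<alpha> \<gamma> =
     - V * (\<Sum>m\<in>sessions G. \<phi> m (\<gamma> m)) +
     (\<Sum>n\<in>nodes G. \<Sum>c\<in>nodes G. q n c * (inflow G \<alpha> n c - outflow G \<alpha> n c)) +
     (\<Sum>m\<in>sessions G. h m * (\<gamma> m - admit \<alpha> m))"

text \<open>
  For fixed queue values the scheduling cost is bounded below over the allowed decisions of a valid
  network, so that the infimum of reals below is a genuine one.
\<close>

definition approx_decision ::
  "('s, 'i) network \<Rightarrow> (nat \<Rightarrow> real \<Rightarrow> real) \<Rightarrow> real \<Rightarrow> real \<Rightarrow> 's event \<Rightarrow>
     (nat \<Rightarrow> nat \<Rightarrow> real) \<Rightarrow> (nat \<Rightarrow> real) \<Rightarrow> 'i action \<Rightarrow> (nat \<Rightarrow> real) \<Rightarrow> bool" where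
  "approx_decision G \<phi> V C w q h \<alpha> \<gamma> \<longleftrightarrow>
     \<alpha> \<in> actions G w \<and> \<gamma> \<in> aux_vectors G \<and>
     scheduling_cost G \<phi> V q h \<alpha> \<gamma> \<le>
       (INF (\<alpha>', \<gamma>') \<in> actions G w \<times> aux_vectors G. scheduling_cost G \<phi> V q h \<alpha>' \<gamma>') + C"

text \<open>
  The quantity $\Phi_r^*$ for frame length \<open>T\<close>. The set is bounded above, and it is nonempty as soon as
  some action is available on each slot of the frame (transmit and admit nothing).
\<close>

definition lookahead_utility ::
  "('s, 'i) network \<Rightarrow> (nat \<Rightarrow> real \<Rightarrow> real) \<Rightarrow> (nat \<Rightarrow> 's event) \<Rightarrow> nat \<Rightarrow> nat \<Rightarrow> real" where
  "lookahead_utility G \<phi> \<omega> T r =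
     Sup {utility G \<phi> (\<lambda>m. 1 / real T * (\<Sum>\<tau>\<in>{r * T..<(r + 1) * T}. admit (\<alpha> \<tau>) m)) | \<alpha>.
       (\<forall>\<tau>\<in>{r * T..<(r + 1) * T}. \<alpha> \<tau> \<in> actions G (\<omega> \<tau>)) \<and>
       (\<forall>n\<in>nodes G. \<forall>c\<in>nodes G. n \<noteq> c \<longrightarrow>
          1 / real T * (\<Sum>\<tau>\<in>{r * T..<(r + 1) * T}. inflow G (\<alpha> \<tau>) n c - outflow G (\<alpha> \<tau>) n c) \<le> 0)}"

end

theory Submission
  imports Defs
begin

text \<open>
  Quadratic Lyapunov drift: on every slot the drift minus \<open>V\<close> times the utility of \<open>\<gamma>\<close> is at most
  \<open>B + C\<close> plus the scheduling cost of any competing decision. Comparing with a fixed feasible policy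
  over a frame of \<open>T\<close> slots and replacing the queues by their values at the beginning of the frame
  costs at most \<open>D T (T - 1)\<close>. Telescoping bounds the average utility of \<open>\<gamma>\<close>.

  The usual last step bounds \<open>H m\<close> by \<open>V \<nu> m + arrival_max m\<close>, which is a property of the exact
  algorithm and fails for approximate implementations. Instead the final Lyapunov value is kept:
  passing from \<open>\<gamma>\<close> to the admitted data loses at most \<open>\<nu> H / (R T)\<close>, and
  \<open>\<nu> H \<le> H\<^sup>2 / (2 V) + V \<nu>\<^sup>2 / 2\<close>.
\<close>

section \<open>Concave functions and the derivative at the left endpoint\<close>

text \<open>Slopes of a concave function decrease: the slope over \<open>[x, y]\<close> is at most
  the slope over \<open>[0, y]\<close>, which is at most the slope over \<open>[0, h]\<close> for
  every \<open>0 < h < y\<close>. Letting \<open>h\<close> tend to 0 gives \<open>d\<close>, so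
  differentiability is used at 0 alone.\<close>

lemma concave_on_increment_le:
  fixes f :: "real \<Rightarrow> real"
  assumes conc: "concave_on {0..A} f"
    and der: "(f has_real_derivative d) (at 0 within {0..A})"
    and xy: "0 \<le> x" "x < y" "y \<le> A"
  shows "f y - f x \<le> d * (y - x)"
proof -
  have cvx: "convex_on {0..A} (\<lambda>z. - f z)"
    using conc by (simp add: concave_on_def)
  have slope: "(f y - f x) / (y - x) \<le> (f h - f 0) / (h - 0)" if h: "0 < h" "h < y" for h
  proof -
    have "(f y - f x) / (y - x) \<le> (f y - f 0) / (y - 0)"
    proof (cases "x = 0")
      case False
      with xy have "(- f 0 - - f y) / (0 - y) \<le> (- f x - - f y) / (x - y)"
        by (intro convex_on_slope_le(2)[OF cvx]) auto
      then show ?thesis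
        using xy by (simp add: field_simps)
    qed simp
    also have "\<dots> \<le> (f h - f 0) / (h - 0)"
    proof -
      have "(- f 0 - - f h) / (0 - h) \<le> (- f 0 - - f y) / (0 - y)"
        using xy h by (intro convex_on_slope_le(1)[OF cvx]) auto
      then show ?thesis
        using xy h by (simp add: field_simps)
    qed
    finally show ?thesis .
  qed
  have "at 0 within {0..A} \<noteq> bot"
    using xy by (simp add: at_within_Icc_at_right)
  moreover have "((\<lambda>h. (f h - f 0) / (h - 0)) \<longlongrightarrow> d) (at 0 within {0..A})"
    using der by (simp add: has_field_derivative_iff)
  \<comment> \<open>The witness \<open>y\<close> is the radius of the neighbourhood: points of the
    interval other than 0 at distance below \<open>y\<close> from 0 satisfy
    \<open>0 < h < y\<close>.\<close>
  moreover have "\<forall>\<^sub>F h in at 0 within {0..A}. (f y - f x) / (y - x) \<le> (f h - f 0) / (h - 0)"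
    unfolding eventually_at using xy slope
    by (intro exI[of _ y]) (auto simp: dist_real_def)
  ultimately have "(f y - f x) / (y - x) \<le> d"
    by (intro tendsto_lowerbound)
  then show ?thesis
    using xy by (simp add: field_simps)
qed

section \<open>Elementary facts on actions, queue updates and sums\<close>

lemma finite_nodes [simp]: "finite (nodes G)"
  by (simp add: nodes_def)

lemma finite_sessions [simp]: "finite (sessions G)"
  by (simp add: sessions_def)

lemma outflow_nonneg:
  "a \<in> actions G w \<Longrightarrow> n \<in> nodes G \<Longrightarrow> c \<in> nodes G \<Longrightarrow> 0 \<le> outflow G a n c"
  by (auto simp: outflow_def actions_def intro: sum_nonneg)

lemma inflow_nonneg:
  "a \<in> actions G w \<Longrightarrow> n \<in> nodes G \<Longrightarrow> c \<in> nodes G \<Longrightarrow> 0 \<le> inflow G a n c"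
  by (auto simp: inflow_def actions_def intro!: sum_nonneg add_nonneg_nonneg)

text \<open>The allocation is kept, so it remains admissible, and zero transmissions respect the
  link rates because these are nonnegative, also on the diagonal. This action later shows that the
  set defining \<open>lookahead_utility\<close> is nonempty.\<close>

lemma idle_action_in_actions:
  assumes "valid_network G" "valid_event G w" "a \<in> actions G w"
  shows "a\<lparr>transmit := \<lambda>_ _ _. 0, admit := \<lambda>_. 0\<rparr> \<in> actions G w"
  using assms unfolding valid_network_def valid_event_def actions_def
  by (auto) (metis order_refl)

text \<open>If \<open>q \<le> b\<close>, the left side is \<open>a\<^sup>2\<close> and the right
  side equals \<open>(q - b)\<^sup>2 + a\<^sup>2 + 2 * (q * a)\<close>. Otherwise the two sides
  differ exactly by \<open>2 * (a * b)\<close>.\<close>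

lemma queue_update_square_le:
  fixes q a b :: real
  assumes "0 \<le> q" "0 \<le> a" "0 \<le> b"
  shows "(max (q - b) 0 + a)\<^sup>2 \<le> q\<^sup>2 + a\<^sup>2 + b\<^sup>2 + 2 * (q * (a - b))"
proof (cases "q \<le> b")
  case True
  have "a\<^sup>2 \<le> (q - b)\<^sup>2 + a\<^sup>2 + 2 * (q * a)"
    using assms by simp
  then show ?thesis
    using True by (simp add: max_def power2_eq_square algebra_simps)
next
  case False
  have "0 \<le> a * b"
    using assms by simp
  then show ?thesis
    using False by (simp add: max_def power2_eq_square algebra_simps)
qed

text \<open>The sum of 0, ..., \<open>T - 1\<close>, doubled to avoid a division. Subtracting 1 in
  the reals keeps the case \<open>T = 0\<close> correct.\<close>

lemma sum_diff_start:
  "(\<Sum>\<tau>\<in>{s..<s + T}. real (\<tau> - s)) * 2 = real T * (real T - 1)"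
  by (induction T) (auto simp: algebra_simps)

lemma average_in_range:
  fixes f :: "nat \<Rightarrow> real"
  assumes "K > 0" "\<And>t. 0 \<le> f t" "\<And>t. f t \<le> A"
  shows "1 / real K * (\<Sum>t<K. f t) \<in> {0..A}"
proof -
  have "(\<Sum>t<K. f t) \<le> (\<Sum>t<K. A)"
    by (intro sum_mono assms)
  then show ?thesis
    using assms by (simp add: sum_nonneg field_simps)
qed

section \<open>A run of the algorithm and the growth of its queues\<close>

text \<open>One run is fixed here while the frame length and the number of frames stay free. The
  bounds are quantified over all admissible actions, since \<open>bmax\<close>, \<open>amax\<close>
  and \<open>D\<close> are also applied to competing policies.\<close>

locale approx_scheduling =
  fixes G :: "('s, 'i) network"
    and \<phi> :: "nat \<Rightarrow> real \<Rightarrow> real" and \<nu> :: "nat \<Rightarrow> real"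
    and \<omega> :: "nat \<Rightarrow> 's event"
    and \<alpha> :: "nat \<Rightarrow> 'i action" and \<gamma> :: "nat \<Rightarrow> nat \<Rightarrow> real"
    and Q :: "nat \<Rightarrow> nat \<Rightarrow> nat \<Rightarrow> real" and H :: "nat \<Rightarrow> nat \<Rightarrow> real"
    and bmax amax :: "nat \<Rightarrow> nat \<Rightarrow> real"
    and V C B D :: real
  assumes network: "valid_network G"
    and utilities: "valid_utilities G \<phi> \<nu>"
    and events: "\<And>t. valid_event G (\<omega> t)"
    and V: "V > 0"
    and Q_dynamics: "queue_dynamics G \<alpha> Q"
    and H_dynamics: "virtual_queue_dynamics G \<alpha> \<gamma> H"
    and Q_init: "\<And>n c. n \<in> nodes G \<Longrightarrow> c \<in> nodes G \<Longrightarrow> Q 0 n c = 0"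
    and H_init: "\<And>m. m \<in> sessions G \<Longrightarrow> H 0 m = 0"
    and approx: "\<And>t. approx_decision G \<phi> V C (\<omega> t) (Q t) (H t) (\<alpha> t) (\<gamma> t)"
    and bmax: "\<And>t a n c. a \<in> actions G (\<omega> t) \<Longrightarrow> n \<in> nodes G \<Longrightarrow> c \<in> nodes G \<Longrightarrow>
        outflow G a n c \<le> bmax n c"
    and amax: "\<And>t a n c. a \<in> actions G (\<omega> t) \<Longrightarrow> n \<in> nodes G \<Longrightarrow> c \<in> nodes G \<Longrightarrow>
        inflow G a n c \<le> amax n c"
    and B: "\<And>t a. a \<in> actions G (\<omega> t) \<Longrightarrow>
        B \<ge> 1 / 2 * (\<Sum>m\<in>sessions G. (arrival_max G m)\<^sup>2) +
            1 / 2 * (\<Sum>n\<in>nodes G. \<Sum>c\<in>nodes G. (outflow G a n c)\<^sup>2 + (inflow G a n c)\<^sup>2)"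
    and D: "\<And>t a. a \<in> actions G (\<omega> t) \<Longrightarrow>
        D \<ge> 1 / 2 * (\<Sum>n\<in>nodes G. \<Sum>c\<in>nodes G.
              max (bmax n c) (amax n c) * max (outflow G a n c) (inflow G a n c)) +
            1 / 2 * (\<Sum>m\<in>sessions G. (arrival_max G m)\<^sup>2)"
begin

lemma action: "\<alpha> t \<in> actions G (\<omega> t)"
  using approx[of t] by (simp add: approx_decision_def)

lemma aux_bounds: "m \<in> sessions G \<Longrightarrow> 0 \<le> \<gamma> t m \<and> \<gamma> t m \<le> arrival_max G m"
  using approx[of t] by (simp add: approx_decision_def aux_vectors_def)

lemma admit_bounds:
  assumes "a \<in> actions G (\<omega> t)" "m \<in> sessions G"
  shows "0 \<le> admit a m" "admit a m \<le> arrival_max G m"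
  using assms events[of t] by (auto simp: actions_def valid_event_def intro: order_trans)

lemma arrival_max_nonneg: "m \<in> sessions G \<Longrightarrow> 0 \<le> arrival_max G m"
  using admit_bounds[OF action[of 0]] by force

lemma Q_diag: "n \<in> nodes G \<Longrightarrow> Q t n n = 0"
  using Q_dynamics by (simp add: queue_dynamics_def)

lemma Q_Suc:
  "n \<in> nodes G \<Longrightarrow> c \<in> nodes G \<Longrightarrow> n \<noteq> c \<Longrightarrow>
    Q (Suc t) n c = max (Q t n c - outflow G (\<alpha> t) n c) 0 + inflow G (\<alpha> t) n c"
  using Q_dynamics by (simp add: queue_dynamics_def)

lemma H_Suc: "m \<in> sessions G \<Longrightarrow> H (Suc t) m = H t m + \<gamma> t m - admit (\<alpha> t) m"
  using H_dynamics by (simp add: virtual_queue_dynamics_def)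

lemma Q_nonneg:
  assumes "n \<in> nodes G" "c \<in> nodes G"
  shows "0 \<le> Q t n c"
proof (induction t)
  case 0
  then show ?case using Q_init assms by simp
next
  case (Suc t)
  show ?case
  proof (cases "n = c")
    case False
    then show ?thesis
      using Q_Suc[OF assms False] inflow_nonneg[OF action assms, of t] by simp
  qed (use Q_diag assms in simp)
qed

text \<open>In one slot the change of a queue is inflow minus the smaller of backlog and outflow,
  hence lies between minus the outflow and the inflow. Induction adds up \<open>k\<close> such
  changes.\<close>

lemma Q_increment_le:
  assumes "n \<in> nodes G" "c \<in> nodes G"
  shows "\<bar>Q (t + k) n c - Q t n c\<bar> \<le> real k * max (bmax n c) (amax n c)"
proof (induction k)
  case (Suc k)
  note bounds = outflow_nonneg[OF action assms, of "t + k"] inflow_nonneg[OF action assms, of "t + k"]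
    bmax[OF action assms, of "t + k"] amax[OF action assms, of "t + k"] Q_nonneg[OF assms, of "t + k"]
  have "\<bar>Q (Suc (t + k)) n c - Q (t + k) n c\<bar> \<le> max (bmax n c) (amax n c)"
  proof (cases "n = c")
    case True
    then show ?thesis using Q_diag[OF assms(1)] bounds by (auto simp: max_def)
  next
    case False
    show ?thesis
      unfolding Q_Suc[OF assms False] using bounds by (auto simp: max_def)
  qed
  then show ?case
    using Suc.IH by (simp add: algebra_simps)
qed simp

lemma H_increment_le:
  assumes "m \<in> sessions G"
  shows "\<bar>H (t + k) m - H t m\<bar> \<le> real k * arrival_max G m"
proof (induction k)
  case (Suc k)
  have "\<bar>H (Suc (t + k)) m - H (t + k) m\<bar> \<le> arrival_max G m"
    using H_Suc[OF assms] aux_bounds[OF assms, of "t + k"]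
      admit_bounds[OF action assms, of "t + k"] by auto
  then show ?case
    using Suc.IH by (simp add: algebra_simps)
qed simp

section \<open>The scheduling cost and its infimum\<close>

text \<open>Monotonicity bounds each utility by its value at \<open>arrival_max G m\<close>, and a
  difference of two nonnegative numbers is at most their maximum in absolute value. The bound does
  not depend on the decision, so the real infimum in \<open>approx_decision\<close> is a genuine
  lower bound.\<close>

lemma scheduling_cost_bounded_below:
  assumes a: "a \<in> actions G (\<omega> t)" and g: "g \<in> aux_vectors G"
  shows "- V * (\<Sum>m\<in>sessions G. \<phi> m (arrival_max G m))
      - (\<Sum>n\<in>nodes G. \<Sum>c\<in>nodes G. \<bar>q n c\<bar> * max (bmax n c) (amax n c))
      - (\<Sum>m\<in>sessions G. \<bar>h m\<bar> * arrival_max G m)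
    \<le> scheduling_cost G \<phi> V q h a g"
proof -
  have "(\<Sum>m\<in>sessions G. \<phi> m (g m)) \<le> (\<Sum>m\<in>sessions G. \<phi> m (arrival_max G m))"
  proof (rule sum_mono)
    fix m assume m: "m \<in> sessions G"
    then have "mono_on {0..arrival_max G m} (\<phi> m)"
      using utilities by (simp add: valid_utilities_def)
    then show "\<phi> m (g m) \<le> \<phi> m (arrival_max G m)"
      using m g arrival_max_nonneg[OF m] by (auto simp: aux_vectors_def intro: mono_onD)
  qed
  then have 1: "V * (\<Sum>m\<in>sessions G. \<phi> m (g m)) \<le> V * (\<Sum>m\<in>sessions G. \<phi> m (arrival_max G m))"
    using V by simp
  have 2: "- (\<Sum>n\<in>nodes G. \<Sum>c\<in>nodes G. \<bar>q n c\<bar> * max (bmax n c) (amax n c))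
      \<le> (\<Sum>n\<in>nodes G. \<Sum>c\<in>nodes G. q n c * (inflow G a n c - outflow G a n c))"
    unfolding sum_negf[symmetric]
  proof (intro sum_mono)
    fix n c assume nc: "n \<in> nodes G" "c \<in> nodes G"
    have "\<bar>q n c * (inflow G a n c - outflow G a n c)\<bar> \<le> \<bar>q n c\<bar> * max (bmax n c) (amax n c)"
      unfolding abs_mult
      using outflow_nonneg[OF a nc] inflow_nonneg[OF a nc] bmax[OF a nc] amax[OF a nc]
      by (intro mult_left_mono) auto
    then show "- (\<bar>q n c\<bar> * max (bmax n c) (amax n c)) \<le> q n c * (inflow G a n c - outflow G a n c)"
      by linarith
  qed
  have 3: "- (\<Sum>m\<in>sessions G. \<bar>h m\<bar> * arrival_max G m) \<le> (\<Sum>m\<in>sessions G. h m * (g m - admit a m))"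
    unfolding sum_negf[symmetric]
  proof (intro sum_mono)
    fix m assume m: "m \<in> sessions G"
    have "\<bar>h m * (g m - admit a m)\<bar> \<le> \<bar>h m\<bar> * arrival_max G m"
      unfolding abs_mult using g m admit_bounds[OF a m]
      by (intro mult_left_mono) (auto simp: aux_vectors_def abs_le_iff dest!: bspec)
    then show "- (\<bar>h m\<bar> * arrival_max G m) \<le> h m * (g m - admit a m)"
      by linarith
  qed
  show ?thesis
    unfolding scheduling_cost_def using 1 2 3 by linarith
qed

lemma scheduling_cost_le:
  assumes "a \<in> actions G (\<omega> t)" "g \<in> aux_vectors G"
  shows "scheduling_cost G \<phi> V (Q t) (H t) (\<alpha> t) (\<gamma> t) \<le> scheduling_cost G \<phi> V (Q t) (H t) a g + C"
proof -
  let ?cost = "\<lambda>(a, g). scheduling_cost G \<phi> V (Q t) (H t) a g"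
  have "bdd_below (?cost ` (actions G (\<omega> t) \<times> aux_vectors G))"
    using scheduling_cost_bounded_below[where q = "Q t" and h = "H t"]
    by (intro bdd_belowI2) auto
  then have "Inf (?cost ` (actions G (\<omega> t) \<times> aux_vectors G)) \<le> ?cost (a, g)"
    using assms by (intro cINF_lower) auto
  then show ?thesis
    using approx[of t] by (simp add: approx_decision_def)
qed

section \<open>Quadratic Lyapunov function and one-slot drift\<close>

text \<open>Half the squared Euclidean norm of all queues. The diagonal pairs contribute nothing
  because \<open>Q t n n = 0\<close>.\<close>

definition lyapunov :: "nat \<Rightarrow> real" where
  "lyapunov t = 1 / 2 * (\<Sum>n\<in>nodes G. \<Sum>c\<in>nodes G. (Q t n c)\<^sup>2) + 1 / 2 * (\<Sum>m\<in>sessions G. (H t m)\<^sup>2)"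

lemma lyapunov_0: "lyapunov 0 = 0"
  by (simp add: lyapunov_def Q_init H_init)

lemma lyapunov_ge: "(\<Sum>m\<in>sessions G. (H t m)\<^sup>2) / 2 \<le> lyapunov t"
  by (simp add: lyapunov_def sum_nonneg)

text \<open>Squaring the queue updates produces second-order terms, whose total is at most
  \<open>B\<close>, and terms linear in the queues. The linear terms together with the utility term
  are exactly the scheduling cost.\<close>

lemma lyapunov_drift_le:
  "lyapunov (Suc t) - lyapunov t - V * utility G \<phi> (\<gamma> t)
    \<le> B + scheduling_cost G \<phi> V (Q t) (H t) (\<alpha> t) (\<gamma> t)"
proof -
  let ?a = "inflow G (\<alpha> t)" and ?b = "outflow G (\<alpha> t)"
  have "(\<Sum>n\<in>nodes G. \<Sum>c\<in>nodes G. (Q (Suc t) n c)\<^sup>2)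
    \<le> (\<Sum>n\<in>nodes G. \<Sum>c\<in>nodes G. (Q t n c)\<^sup>2 + ((?b n c)\<^sup>2 + (?a n c)\<^sup>2) + 2 * (Q t n c * (?a n c - ?b n c)))"
  proof (intro sum_mono)
    fix n c assume nc: "n \<in> nodes G" "c \<in> nodes G"
    show "(Q (Suc t) n c)\<^sup>2 \<le> (Q t n c)\<^sup>2 + ((?b n c)\<^sup>2 + (?a n c)\<^sup>2) + 2 * (Q t n c * (?a n c - ?b n c))"
    proof (cases "n = c")
      case True
      then show ?thesis using Q_diag[OF nc(1)] by simp
    next
      case False
      show ?thesis
        unfolding Q_Suc[OF nc False]
        using queue_update_square_le[OF Q_nonneg[OF nc] inflow_nonneg[OF action nc] outflow_nonneg[OF action nc],
            of t t t]
        by (simp add: add_ac)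
    qed
  qed
  then have 1: "(\<Sum>n\<in>nodes G. \<Sum>c\<in>nodes G. (Q (Suc t) n c)\<^sup>2)
    \<le> (\<Sum>n\<in>nodes G. \<Sum>c\<in>nodes G. (Q t n c)\<^sup>2)
      + (\<Sum>n\<in>nodes G. \<Sum>c\<in>nodes G. (?b n c)\<^sup>2 + (?a n c)\<^sup>2)
      + 2 * (\<Sum>n\<in>nodes G. \<Sum>c\<in>nodes G. Q t n c * (?a n c - ?b n c))"
    by (simp add: sum.distrib sum_distrib_left)
  have "(\<Sum>m\<in>sessions G. (H (Suc t) m)\<^sup>2)
    \<le> (\<Sum>m\<in>sessions G. (H t m)\<^sup>2 + (arrival_max G m)\<^sup>2 + 2 * (H t m * (\<gamma> t m - admit (\<alpha> t) m)))"
  proof (intro sum_mono)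
    fix m assume m: "m \<in> sessions G"
    have "(\<gamma> t m - admit (\<alpha> t) m)\<^sup>2 \<le> (arrival_max G m)\<^sup>2"
      using aux_bounds[OF m, of t] admit_bounds[OF action m, of t]
      by (intro abs_le_square_iff[THEN iffD1]) auto
    then show "(H (Suc t) m)\<^sup>2
        \<le> (H t m)\<^sup>2 + (arrival_max G m)\<^sup>2 + 2 * (H t m * (\<gamma> t m - admit (\<alpha> t) m))"
      unfolding H_Suc[OF m] by (simp add: power2_eq_square algebra_simps)
  qed
  then have 2: "(\<Sum>m\<in>sessions G. (H (Suc t) m)\<^sup>2)
    \<le> (\<Sum>m\<in>sessions G. (H t m)\<^sup>2) + (\<Sum>m\<in>sessions G. (arrival_max G m)\<^sup>2)
      + 2 * (\<Sum>m\<in>sessions G. H t m * (\<gamma> t m - admit (\<alpha> t) m))"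
    by (simp add: sum.distrib sum_distrib_left)
  show ?thesis
    using 1 2 B[OF action[of t]]
    unfolding lyapunov_def scheduling_cost_def utility_def by (simp add: field_simps)
qed

section \<open>Comparison with a competing policy over a frame\<close>

text \<open>The cost is affine in the queues. Over \<open>k\<close> slots each queue moves by at
  most \<open>k\<close> times its one-slot bound, and its coefficient is at most the larger of
  inflow and outflow, respectively \<open>arrival_max G m\<close>. The sum of these products is
  twice the expression bounded by \<open>D\<close>, hence \<open>2 * D\<close>.\<close>

lemma scheduling_cost_shift_le:
  assumes a: "a \<in> actions G (\<omega> (s + k))" and g: "g \<in> aux_vectors G"
  shows "scheduling_cost G \<phi> V (Q (s + k)) (H (s + k)) a g
    \<le> scheduling_cost G \<phi> V (Q s) (H s) a g + real k * (2 * D)"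
proof -
  have "(\<Sum>n\<in>nodes G. \<Sum>c\<in>nodes G. Q (s + k) n c * (inflow G a n c - outflow G a n c))
    \<le> (\<Sum>n\<in>nodes G. \<Sum>c\<in>nodes G. Q s n c * (inflow G a n c - outflow G a n c)
        + real k * (max (bmax n c) (amax n c) * max (outflow G a n c) (inflow G a n c)))"
  proof (intro sum_mono)
    fix n c assume nc: "n \<in> nodes G" "c \<in> nodes G"
    have "\<bar>(Q (s + k) n c - Q s n c) * (inflow G a n c - outflow G a n c)\<bar>
      \<le> (real k * max (bmax n c) (amax n c)) * max (outflow G a n c) (inflow G a n c)"
      unfolding abs_mult
      using outflow_nonneg[OF a nc] inflow_nonneg[OF a nc] bmax[OF a nc] Q_increment_le[OF nc, of s k]
      by (intro mult_mono) auto
    then show "Q (s + k) n c * (inflow G a n c - outflow G a n c)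
      \<le> Q s n c * (inflow G a n c - outflow G a n c)
        + real k * (max (bmax n c) (amax n c) * max (outflow G a n c) (inflow G a n c))"
      by (simp add: left_diff_distrib mult.assoc)
  qed
  then have 1: "(\<Sum>n\<in>nodes G. \<Sum>c\<in>nodes G. Q (s + k) n c * (inflow G a n c - outflow G a n c))
    \<le> (\<Sum>n\<in>nodes G. \<Sum>c\<in>nodes G. Q s n c * (inflow G a n c - outflow G a n c))
      + real k * (\<Sum>n\<in>nodes G. \<Sum>c\<in>nodes G. max (bmax n c) (amax n c) * max (outflow G a n c) (inflow G a n c))"
    by (simp add: sum.distrib sum_distrib_left)
  have "(\<Sum>m\<in>sessions G. H (s + k) m * (g m - admit a m))
    \<le> (\<Sum>m\<in>sessions G. H s m * (g m - admit a m) + real k * (arrival_max G m)\<^sup>2)"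
  proof (intro sum_mono)
    fix m assume m: "m \<in> sessions G"
    have "0 \<le> g m" "g m \<le> arrival_max G m"
      using g m by (auto simp: aux_vectors_def)
    then have "\<bar>(H (s + k) m - H s m) * (g m - admit a m)\<bar> \<le> (real k * arrival_max G m) * arrival_max G m"
      unfolding abs_mult
      using m admit_bounds[OF a m] H_increment_le[OF m, of s k]
      by (intro mult_mono) auto
    then show "H (s + k) m * (g m - admit a m)
      \<le> H s m * (g m - admit a m) + real k * (arrival_max G m)\<^sup>2"
      by (simp add: left_diff_distrib mult.assoc power2_eq_square)
  qed
  then have 2: "(\<Sum>m\<in>sessions G. H (s + k) m * (g m - admit a m))
    \<le> (\<Sum>m\<in>sessions G. H s m * (g m - admit a m)) + real k * (\<Sum>m\<in>sessions G. (arrival_max G m)\<^sup>2)"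
    by (simp add: sum.distrib sum_distrib_left)
  have 3: "real k * (\<Sum>n\<in>nodes G. \<Sum>c\<in>nodes G. max (bmax n c) (amax n c) * max (outflow G a n c) (inflow G a n c))
      + real k * (\<Sum>m\<in>sessions G. (arrival_max G m)\<^sup>2) \<le> real k * (2 * D)"
    unfolding distrib_left[symmetric] using D[OF a] by (intro mult_left_mono) auto
  show ?thesis
    unfolding scheduling_cost_def using 1 2 3 by linarith
qed

text \<open>The competitor uses the actions \<open>a\<close> and, in every slot of the frame, the
  same auxiliary vector \<open>g\<close>, the average of its own admissions. With the queues frozen
  at time \<open>s\<close>, its linear cost terms then sum to at most 0.\<close>

lemma frame_drift_le:
  fixes s T :: nat and a :: "nat \<Rightarrow> 'i action"
  defines "F \<equiv> {s..<s + T}"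
  defines "g \<equiv> \<lambda>m. 1 / real T * (\<Sum>\<tau>\<in>F. admit (a \<tau>) m)"
  assumes T: "T > 0"
    and a: "\<And>\<tau>. \<tau> \<in> F \<Longrightarrow> a \<tau> \<in> actions G (\<omega> \<tau>)"
    and stable: "\<And>n c. n \<in> nodes G \<Longrightarrow> c \<in> nodes G \<Longrightarrow> n \<noteq> c \<Longrightarrow>
      (\<Sum>\<tau>\<in>F. inflow G (a \<tau>) n c - outflow G (a \<tau>) n c) \<le> 0"
  shows "lyapunov (s + T) - lyapunov s - V * (\<Sum>\<tau>\<in>F. utility G \<phi> (\<gamma> \<tau>))
    \<le> real T * (B + C) + D * (real T * (real T - 1)) - V * (real T * utility G \<phi> g)"
proof -
  have g: "g \<in> aux_vectors G"
    unfolding aux_vectors_def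
  proof (clarsimp, intro conjI)
    fix m assume m: "m \<in> sessions G"
    show "0 \<le> g m"
      unfolding g_def using admit_bounds(1)[OF a m] by (simp add: sum_nonneg)
    have "(\<Sum>\<tau>\<in>F. admit (a \<tau>) m) \<le> (\<Sum>\<tau>\<in>F. arrival_max G m)"
      using admit_bounds(2)[OF a m] by (intro sum_mono)
    then show "g m \<le> arrival_max G m"
      unfolding g_def using T by (simp add: F_def field_simps)
  qed
  \<comment> \<open>Three estimates are chained: the drift bound, near-optimality against
    \<open>(a \<tau>, g)\<close>, and the replacement of the queues at \<open>\<tau>\<close> by
    those at \<open>s\<close>.\<close>
  have slot: "lyapunov (Suc \<tau>) - lyapunov \<tau> - V * utility G \<phi> (\<gamma> \<tau>)
      \<le> B + C + D * (real (\<tau> - s) * 2) + scheduling_cost G \<phi> V (Q s) (H s) (a \<tau>) g"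
    if "\<tau> \<in> F" for \<tau>
  proof -
    have "s + (\<tau> - s) = \<tau>"
      using that by (simp add: F_def)
    then show ?thesis
      using lyapunov_drift_le[of \<tau>] scheduling_cost_le[OF a[OF that] g]
        scheduling_cost_shift_le[of "a \<tau>" s "\<tau> - s" g] a[OF that] g by (simp add: mult_ac)
  qed
  have Q0: "(\<Sum>\<tau>\<in>F. \<Sum>n\<in>nodes G. \<Sum>c\<in>nodes G.
      Q s n c * (inflow G (a \<tau>) n c - outflow G (a \<tau>) n c)) \<le> 0"
  proof -
    have "(\<Sum>\<tau>\<in>F. \<Sum>n\<in>nodes G. \<Sum>c\<in>nodes G. Q s n c * (inflow G (a \<tau>) n c - outflow G (a \<tau>) n c))
      = (\<Sum>n\<in>nodes G. \<Sum>c\<in>nodes G. \<Sum>\<tau>\<in>F. Q s n c * (inflow G (a \<tau>) n c - outflow G (a \<tau>) n c))"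
      by (subst sum.swap, rule sum.cong[OF refl], rule sum.swap)
    also have "\<dots> = (\<Sum>n\<in>nodes G. \<Sum>c\<in>nodes G. Q s n c * (\<Sum>\<tau>\<in>F. inflow G (a \<tau>) n c - outflow G (a \<tau>) n c))"
      by (simp only: sum_distrib_left)
    also have "\<dots> \<le> 0"
    proof (intro sum_nonpos)
      fix n c assume nc: "n \<in> nodes G" "c \<in> nodes G"
      show "Q s n c * (\<Sum>\<tau>\<in>F. inflow G (a \<tau>) n c - outflow G (a \<tau>) n c) \<le> 0"
      proof (cases "n = c")
        case False
        then show ?thesis
          using Q_nonneg[OF nc] stable[OF nc False] by (intro mult_nonneg_nonpos)
      qed (use Q_diag nc in simp)
    qed
    finally show ?thesis .
  qed
  \<comment> \<open>\<open>H s m\<close> may have either sign, so exact cancellation is needed; the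
    choice of \<open>g\<close> as the frame average provides it.\<close>
  have H0: "(\<Sum>\<tau>\<in>F. \<Sum>m\<in>sessions G. H s m * (g m - admit (a \<tau>) m)) = 0"
  proof -
    have "(\<Sum>\<tau>\<in>F. g m - admit (a \<tau>) m) = 0" for m
      using T by (simp add: sum_subtractf g_def F_def)
    then show ?thesis
      by (subst sum.swap) (simp add: sum_distrib_left[symmetric])
  qed
  have cost: "(\<Sum>\<tau>\<in>F. scheduling_cost G \<phi> V (Q s) (H s) (a \<tau>) g) \<le> - V * (real T * utility G \<phi> g)"
    using Q0 H0 unfolding scheduling_cost_def utility_def sum.distrib by (simp add: F_def)
  have "lyapunov (s + T) - lyapunov s - V * (\<Sum>\<tau>\<in>F. utility G \<phi> (\<gamma> \<tau>))
    = (\<Sum>\<tau>\<in>F. lyapunov (Suc \<tau>) - lyapunov \<tau> - V * utility G \<phi> (\<gamma> \<tau>))"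
    by (simp add: sum_subtractf[of "\<lambda>\<tau>. lyapunov (Suc \<tau>) - lyapunov \<tau>"] F_def
        sum_Suc_diff' sum_distrib_left)
  also have "\<dots> \<le> (\<Sum>\<tau>\<in>F. B + C + D * (real (\<tau> - s) * 2)
      + scheduling_cost G \<phi> V (Q s) (H s) (a \<tau>) g)"
    by (intro sum_mono slot)
  also have "\<dots> = real T * (B + C) + D * ((\<Sum>\<tau>\<in>F. real (\<tau> - s)) * 2)
      + (\<Sum>\<tau>\<in>F. scheduling_cost G \<phi> V (Q s) (H s) (a \<tau>) g)"
    by (simp add: sum.distrib sum_distrib_left sum_distrib_right F_def)
  also have "\<dots> \<le> real T * (B + C) + D * (real T * (real T - 1)) - V * (real T * utility G \<phi> g)"
    using cost unfolding F_def sum_diff_start by simp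
  finally show ?thesis .
qed

text \<open>The supremum need not be attained, so the frame bound is solved for the utility of an
  arbitrary feasible competitor, dividing by \<open>V * real T\<close>, and then passed to the
  supremum.\<close>

lemma frame_drift_lookahead_le:
  assumes T: "T > 0"
  shows "lyapunov (Suc r * T) - lyapunov (r * T) - V * (\<Sum>\<tau>\<in>{r * T..<r * T + T}. utility G \<phi> (\<gamma> \<tau>))
    \<le> real T * (B + C) + D * (real T * (real T - 1)) - V * (real T * lookahead_utility G \<phi> \<omega> T r)"
    (is "?drift \<le> ?const - _")
proof -
  have VT: "V * real T > 0"
    using V T by simp
  have end_frame: "(r + 1) * T = r * T + T" "Suc r * T = r * T + T"
    by simp_all
  let ?idle = "\<lambda>\<tau>. (\<alpha> \<tau>)\<lparr>transmit := \<lambda>_ _ _. 0, admit := \<lambda>_. 0\<rparr>"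
  have "lookahead_utility G \<phi> \<omega> T r \<le> (?const - ?drift) / (V * real T)"
    unfolding lookahead_utility_def end_frame
  proof (rule cSup_least, goal_cases)
    case 1
    have "\<forall>\<tau>. ?idle \<tau> \<in> actions G (\<omega> \<tau>)"
      using idle_action_in_actions[OF network events action] by blast
    moreover have "inflow G (?idle \<tau>) n c - outflow G (?idle \<tau>) n c = 0" for \<tau> n c
      by (simp add: inflow_def outflow_def)
    ultimately show ?case
      by (auto intro!: exI[of _ ?idle])
  next
    case (2 u)
    then obtain a where u: "u = utility G \<phi> (\<lambda>m. 1 / real T * (\<Sum>\<tau>\<in>{r * T..<r * T + T}. admit (a \<tau>) m))"
      and a: "\<And>\<tau>. \<tau> \<in> {r * T..<r * T + T} \<Longrightarrow> a \<tau> \<in> actions G (\<omega> \<tau>)"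
      and stable: "\<And>n c. n \<in> nodes G \<Longrightarrow> c \<in> nodes G \<Longrightarrow> n \<noteq> c \<Longrightarrow>
        1 / real T * (\<Sum>\<tau>\<in>{r * T..<r * T + T}. inflow G (a \<tau>) n c - outflow G (a \<tau>) n c) \<le> 0"
      by blast
    have "(\<Sum>\<tau>\<in>{r * T..<r * T + T}. inflow G (a \<tau>) n c - outflow G (a \<tau>) n c) \<le> 0"
      if "n \<in> nodes G" "c \<in> nodes G" "n \<noteq> c" for n c
      using stable[OF that] T by (simp add: divide_le_0_iff)
    from frame_drift_le[OF T a this]
    have "?drift \<le> ?const - V * (real T * u)"
      unfolding u end_frame by blast
    then show ?case
      using VT by (simp add: pos_le_divide_eq algebra_simps)
  qed
  then show ?thesis
    using VT by (simp add: pos_le_divide_eq algebra_simps)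
qed

text \<open>The frame bounds telescope over \<open>R\<close> frames from
  \<open>lyapunov 0 = 0\<close> and are divided by \<open>V * (real R * real T)\<close>. The final
  Lyapunov value is retained for use against the virtual queues.\<close>

lemma average_aux_utility_ge:
  assumes R: "R > 0" and T: "T > 0"
  shows "1 / (real R * real T) * (\<Sum>t<R * T. utility G \<phi> (\<gamma> t))
    \<ge> 1 / real R * (\<Sum>r<R. lookahead_utility G \<phi> \<omega> T r) - (B + C) / V - D * (real T - 1) / V
      + lyapunov (R * T) / (V * (real R * real T))"
proof -
  have "lyapunov (R * T) - V * (\<Sum>t<R * T. utility G \<phi> (\<gamma> t))
    = (\<Sum>r<R. lyapunov (Suc r * T) - lyapunov (r * T)
        - V * (\<Sum>\<tau>\<in>{r * T..<r * T + T}. utility G \<phi> (\<gamma> \<tau>)))"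
    \<comment> \<open>\<open>sum.nat_group\<close> regroups the \<open>R * T\<close> slots into
      \<open>R\<close> consecutive blocks of length \<open>T\<close>.\<close>
    using sum_lessThan_telescope[of "\<lambda>r. lyapunov (r * T)" R]
    by (simp only: sum_subtractf sum_distrib_left[symmetric] sum.nat_group) (simp add: lyapunov_0)
  also have "\<dots> \<le> (\<Sum>r<R. real T * (B + C) + D * (real T * (real T - 1))
      - V * (real T * lookahead_utility G \<phi> \<omega> T r))"
    by (intro sum_mono frame_drift_lookahead_le T)
  also have "\<dots> = real R * (real T * (B + C) + D * (real T * (real T - 1)))
      - V * (real T * (\<Sum>r<R. lookahead_utility G \<phi> \<omega> T r))"
    by (simp add: sum_subtractf sum_distrib_left)
  finally have main: "lyapunov (R * T) - V * (\<Sum>t<R * T. utility G \<phi> (\<gamma> t)) \<le> \<dots>" .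
  have pos: "V * (real R * real T) > 0"
    using V R T by simp
  have "(lyapunov (R * T) - V * (\<Sum>t<R * T. utility G \<phi> (\<gamma> t))) / (V * (real R * real T))
    \<le> (real R * (real T * (B + C) + D * (real T * (real T - 1)))
      - V * (real T * (\<Sum>r<R. lookahead_utility G \<phi> \<omega> T r))) / (V * (real R * real T))"
    using main pos by (intro divide_right_mono) auto
  also have "\<dots> = (B + C) / V + D * (real T - 1) / V
      - 1 / real R * (\<Sum>r<R. lookahead_utility G \<phi> \<omega> T r)"
    using V R T by (simp add: field_simps)
  also have "(lyapunov (R * T) - V * (\<Sum>t<R * T. utility G \<phi> (\<gamma> t))) / (V * (real R * real T))
    = lyapunov (R * T) / (V * (real R * real T))
      - 1 / (real R * real T) * (\<Sum>t<R * T. utility G \<phi> (\<gamma> t))"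
    using V R T by (simp add: field_simps)
  finally show ?thesis
    by linarith
qed

lemma H_eq_sum:
  "m \<in> sessions G \<Longrightarrow> H t m = (\<Sum>\<tau><t. \<gamma> \<tau> m) - (\<Sum>\<tau><t. admit (\<alpha> \<tau>) m)"
  by (induction t) (simp_all add: H_init H_Suc)

lemma session_utility_ge:
  assumes m: "m \<in> sessions G" and K: "K > 0"
  shows "\<phi> m (1 / real K * (\<Sum>t<K. admit (\<alpha> t) m))
    \<ge> 1 / real K * (\<Sum>t<K. \<phi> m (\<gamma> t m)) - ((H K m)\<^sup>2 / (2 * V) + V * (\<nu> m)\<^sup>2 / 2) / real K"
proof -
  define x where "x = 1 / real K * (\<Sum>t<K. admit (\<alpha> t) m)"
  define y where "y = 1 / real K * (\<Sum>t<K. \<gamma> t m)"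
  have x: "x \<in> {0..arrival_max G m}"
    unfolding x_def using K admit_bounds[OF action m] by (intro average_in_range)
  have y: "y \<in> {0..arrival_max G m}"
    unfolding y_def using K aux_bounds[OF m] by (intro average_in_range) auto
  have yx: "y - x = H K m / real K"
    unfolding x_def y_def H_eq_sum[OF m] by (simp add: diff_divide_distrib)
  have conc: "concave_on {0..arrival_max G m} (\<phi> m)" and mono: "mono_on {0..arrival_max G m} (\<phi> m)"
    and der: "(\<phi> m has_real_derivative \<nu> m) (at 0 within {0..arrival_max G m})"
    using utilities m by (auto simp: valid_utilities_def)
  have jensen: "1 / real K * (\<Sum>t<K. \<phi> m (\<gamma> t m)) \<le> \<phi> m y"
    using concave_on_sum[of "{..<K}" _ "\<phi> m" "\<lambda>_. 1 / real K" "\<lambda>t. \<gamma> t m", OF _ _ conc] K aux_bounds[OF m]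
    by (simp add: y_def sum_divide_distrib lessThan_empty_iff)
  \<comment> \<open>The weights are chosen so that the coefficient of the square of
    \<open>H K m\<close> is \<open>1 / (2 * V)\<close>, the one it has in the Lyapunov function
    divided by \<open>V\<close>.\<close>
  have young: "\<nu> m * H K m \<le> (H K m)\<^sup>2 / (2 * V) + V * (\<nu> m)\<^sup>2 / 2"
  proof -
    have "0 \<le> (H K m - V * \<nu> m)\<^sup>2 / (2 * V)"
      using V by simp
    then show ?thesis
      using V by (simp add: power2_eq_square field_simps)
  qed
  have "\<phi> m y - \<phi> m x \<le> ((H K m)\<^sup>2 / (2 * V) + V * (\<nu> m)\<^sup>2 / 2) / real K"
  proof (cases "x < y")
    case True
    then have "\<phi> m y - \<phi> m x \<le> \<nu> m * (y - x)"
      using x y by (intro concave_on_increment_le[OF conc der]) auto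
    also have "\<dots> = \<nu> m * H K m / real K"
      by (simp add: yx)
    also have "\<dots> \<le> ((H K m)\<^sup>2 / (2 * V) + V * (\<nu> m)\<^sup>2 / 2) / real K"
      using young by (intro divide_right_mono) auto
    finally show ?thesis .
  next
    case False
    then have "\<phi> m y \<le> \<phi> m x"
      using x y by (intro mono_onD[OF mono]) auto
    moreover have "0 \<le> ((H K m)\<^sup>2 / (2 * V) + V * (\<nu> m)\<^sup>2 / 2) / real K"
      using V by simp
    ultimately show ?thesis
      by linarith
  qed
  then show ?thesis
    using jensen unfolding x_def by linarith
qed

text \<open>Summed over the sessions, the squares of the virtual queues are absorbed by the retained
  Lyapunov value. What remains is half of \<open>V * (\<nu> m)\<^sup>2\<close> per session, divided
  by \<open>real R * real T\<close>, which lies below the claimed error.\<close>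

lemma admitted_utility_ge:
  assumes R: "R > 0" and T: "T > 0"
  shows "utility G \<phi> (\<lambda>m. 1 / (real R * real T) * (\<Sum>\<tau><R * T. admit (\<alpha> \<tau>) m))
    \<ge> 1 / real R * (\<Sum>r<R. lookahead_utility G \<phi> \<omega> T r)
      - (B + C) / V - D * (real T - 1) / V
      - (\<Sum>m\<in>sessions G. \<nu> m * (V * \<nu> m + arrival_max G m) / (real R * real T))"
proof -
  let ?K = "real R * real T"
  let ?S = "\<lambda>m. (H (R * T) m)\<^sup>2"
  have K: "?K > 0"
    using R T by simp
  have "(\<Sum>m\<in>sessions G. 1 / ?K * (\<Sum>t<R * T. \<phi> m (\<gamma> t m)) - (?S m / (2 * V) + V * (\<nu> m)\<^sup>2 / 2) / ?K)
    \<le> utility G \<phi> (\<lambda>m. 1 / ?K * (\<Sum>\<tau><R * T. admit (\<alpha> \<tau>) m))"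
    unfolding utility_def using session_utility_ge[where K = "R * T"] R T
    by (intro sum_mono) simp
  moreover have "(\<Sum>m\<in>sessions G. 1 / ?K * (\<Sum>t<R * T. \<phi> m (\<gamma> t m)) - (?S m / (2 * V) + V * (\<nu> m)\<^sup>2 / 2) / ?K)
    = 1 / ?K * (\<Sum>t<R * T. utility G \<phi> (\<gamma> t))
      - (\<Sum>m\<in>sessions G. ?S m) / 2 / (V * ?K) - (\<Sum>m\<in>sessions G. V * (\<nu> m)\<^sup>2 / 2 / ?K)"
  proof -
    have "(\<Sum>m\<in>sessions G. 1 / ?K * (\<Sum>t<R * T. \<phi> m (\<gamma> t m))) = 1 / ?K * (\<Sum>t<R * T. utility G \<phi> (\<gamma> t))"
      unfolding utility_def by (subst sum.swap) (simp only: sum_distrib_left)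
    then show ?thesis
      by (simp add: sum_subtractf sum.distrib add_divide_distrib sum_divide_distrib mult_ac)
  qed
  moreover have "(\<Sum>m\<in>sessions G. ?S m) / 2 / (V * ?K) \<le> lyapunov (R * T) / (V * ?K)"
    using lyapunov_ge V K by (intro divide_right_mono) auto
  moreover have "(\<Sum>m\<in>sessions G. V * (\<nu> m)\<^sup>2 / 2 / ?K)
    \<le> (\<Sum>m\<in>sessions G. \<nu> m * (V * \<nu> m + arrival_max G m) / ?K)"
  proof (intro sum_mono divide_right_mono)
    fix m assume m: "m \<in> sessions G"
    then have "0 \<le> \<nu> m * arrival_max G m" "0 \<le> V * (\<nu> m)\<^sup>2"
      using utilities arrival_max_nonneg V by (auto simp: valid_utilities_def)
    then show "V * (\<nu> m)\<^sup>2 / 2 \<le> \<nu> m * (V * \<nu> m + arrival_max G m)"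
      by (simp add: power2_eq_square algebra_simps)
  qed (use K in simp)
  ultimately show ?thesis
    using average_aux_utility_ge[OF R T] by linarith
qed

end

theorem mainTheorem2:
  fixes G :: "('s, 'i) network"
    and \<phi> :: "nat \<Rightarrow> real \<Rightarrow> real" and \<nu> :: "nat \<Rightarrow> real"
    and \<omega> :: "nat \<Rightarrow> 's event"
    and \<alpha> :: "nat \<Rightarrow> 'i action" and \<gamma> :: "nat \<Rightarrow> nat \<Rightarrow> real"
    and Q :: "nat \<Rightarrow> nat \<Rightarrow> nat \<Rightarrow> real" and H :: "nat \<Rightarrow> nat \<Rightarrow> real"
    and bmax amax :: "nat \<Rightarrow> nat \<Rightarrow> real"
    and V C B D :: real and R T :: nat
  assumes network: "valid_network G"
    and utilities: "valid_utilities G \<phi> \<nu>"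
    and events: "\<And>t. valid_event G (\<omega> t)"
    and V: "V > 0" and C: "C \<ge> 0"
    and Q_dynamics: "queue_dynamics G \<alpha> Q"
    and H_dynamics: "virtual_queue_dynamics G \<alpha> \<gamma> H"
    and Q_init: "\<And>n c. n \<in> nodes G \<Longrightarrow> c \<in> nodes G \<Longrightarrow> Q 0 n c = 0"
    and H_init: "\<And>m. m \<in> sessions G \<Longrightarrow> H 0 m = 0"
    and approx: "\<And>t. approx_decision G \<phi> V C (\<omega> t) (Q t) (H t) (\<alpha> t) (\<gamma> t)"
    and bmax: "\<And>t a n c. a \<in> actions G (\<omega> t) \<Longrightarrow> n \<in> nodes G \<Longrightarrow> c \<in> nodes G \<Longrightarrow>
        outflow G a n c \<le> bmax n c"
    and amax: "\<And>t a n c. a \<in> actions G (\<omega> t) \<Longrightarrow> n \<in> nodes G \<Longrightarrow> c \<in> nodes G \<Longrightarrow>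
        inflow G a n c \<le> amax n c"
    and B: "\<And>t a. a \<in> actions G (\<omega> t) \<Longrightarrow>
        B \<ge> 1 / 2 * (\<Sum>m\<in>sessions G. (arrival_max G m)\<^sup>2) +
            1 / 2 * (\<Sum>n\<in>nodes G. \<Sum>c\<in>nodes G. (outflow G a n c)\<^sup>2 + (inflow G a n c)\<^sup>2)"
    and D: "\<And>t a. a \<in> actions G (\<omega> t) \<Longrightarrow>
        D \<ge> 1 / 2 * (\<Sum>n\<in>nodes G. \<Sum>c\<in>nodes G.
              max (bmax n c) (amax n c) * max (outflow G a n c) (inflow G a n c)) +
            1 / 2 * (\<Sum>m\<in>sessions G. (arrival_max G m)\<^sup>2)"
    and R: "R > 0" and T: "T > 0"
  shows "let xbar = (\<lambda>m. 1 / (real R * real T) * (\<Sum>\<tau><R * T. admit (\<alpha> \<tau>) m));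
             B1 = (B + C - D) / real T + D;
             B2 = (\<Sum>m\<in>sessions G. \<nu> m * (\<nu> m + arrival_max G m / V))
         in utility G \<phi> xbar \<ge>
              1 / real R * (\<Sum>r<R. lookahead_utility G \<phi> \<omega> T r)
              - (B + C) / V - D * (real T - 1) / V
              - (\<Sum>m\<in>sessions G. \<nu> m * (V * \<nu> m + arrival_max G m) / (real R * real T)) \<and>
            utility G \<phi> xbar \<ge>
              1 / real R * (\<Sum>r<R. lookahead_utility G \<phi> \<omega> T r)
              - B1 * real T / V - B2 * V / (real R * real T)"
proof -
  interpret approx_scheduling G \<phi> \<nu> \<omega> \<alpha> \<gamma> Q H bmax amax V C B D
    by (unfold_locales; fact assms)
  let ?sum = "\<Sum>m\<in>sessions G. \<nu> m * (V * \<nu> m + arrival_max G m) / (real R * real T)"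
  \<comment> \<open>The two forms of the bound agree term by term, since \<open>B1 * real T\<close>
    equals \<open>B + C + D * (real T - 1)\<close>.\<close>
  have "((B + C - D) / real T + D) * real T / V = (B + C) / V + D * (real T - 1) / V"
    using V T by (simp add: field_simps)
  moreover have "(\<Sum>m\<in>sessions G. \<nu> m * (\<nu> m + arrival_max G m / V)) * V / (real R * real T) = ?sum"
    unfolding sum_distrib_right sum_divide_distrib
    using V R T by (intro sum.cong refl) (simp add: field_simps)
  ultimately show ?thesis
    using admitted_utility_ge[OF R T] by (simp add: Let_def)
qed

end
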